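(* Let $\Bbbk$ be a field, let $R=\Bbbk[x,y,z,w]$, let $\boldsymbol{m}=x^{2},w^{2},zw,xy,yz$, and let $F$ be the minimal free resolution of $R/\boldsymbol{m}$ over $R$, with the homogeneous basis $\{\varepsilon_\sigma\}$ specified in the context. Every multiplication $\star$ on $F$ is non-associative at the triple $(\varepsilon_{1},\varepsilon_{45},\varepsilon_{2})$, i.e. $(\varepsilon_1\star\varepsilon_{45})\star\varepsilon_2-\varepsilon_1\star(\varepsilon_{45}\star\varepsilon_2)\neq 0$.
   Context: $R/\boldsymbol{m}$ denotes the quotient of $R$ by the ideal generated by the monomials in $\boldsymbol{m}$. A multiplication on $F$ is a chain map $F\otimes_R F\to F$, $a_1\otimes a_2\mapsto a_1\star a_2$, which is unital with identity $1\in F_0=R$ and strictly graded-commutative: $a_1\star a_2=(-1)^{|a_1||a_2|}a_2\star a_1$ for homogeneous $a_1,a_2$, and $a\star a=0$ for $|a|$ odd. It is not required to be associative or multigraded. The resolution $F$ is the complex of free $R$-modules with bases $F_0=R$; $F_1$: $\varepsilon_1,\varepsilon_2,\varepsilon_3,\varepsilon_4,\varepsilon_5$; $F_2$: $\varepsilon_{12},\varepsilon_{13},\varepsilon_{14},\varepsilon_{23},\varepsilon_{24},\varepsilon_{35},\varepsilon_{45}$; $F_3$: $\varepsilon_{123},\varepsilon_{124},\varepsilon_{1345},\varepsilon_{2345}$; $F_4$: $\varepsilon_{12345}$; and with differential $\mathrm{d}\varepsilon_1=x^2$, $\mathrm{d}\varepsilon_2=w^2$, $\mathrm{d}\varepsilon_3=zw$,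 $\mathrm{d}\varepsilon_4=xy$, $\mathrm{d}\varepsilon_5=yz$; $\mathrm{d}\varepsilon_{12}=x^2\varepsilon_2-w^2\varepsilon_1$, $\mathrm{d}\varepsilon_{13}=x^2\varepsilon_3-zw\varepsilon_1$, $\mathrm{d}\varepsilon_{14}=x\varepsilon_4-y\varepsilon_1$, $\mathrm{d}\varepsilon_{23}=w\varepsilon_3-z\varepsilon_2$, $\mathrm{d}\varepsilon_{24}=w^2\varepsilon_4-xy\varepsilon_2$, $\mathrm{d}\varepsilon_{35}=w\varepsilon_5-y\varepsilon_3$, $\mathrm{d}\varepsilon_{45}=x\varepsilon_5-z\varepsilon_4$; $\mathrm{d}\varepsilon_{123}=x^2\varepsilon_{23}-w\varepsilon_{13}+z\varepsilon_{12}$, $\mathrm{d}\varepsilon_{124}=x\varepsilon_{24}-w^2\varepsilon_{14}+y\varepsilon_{12}$, $\mathrm{d}\varepsilon_{1345}=x^2\varepsilon_{35}-xw\varepsilon_{45}-zw\varepsilon_{14}+y\varepsilon_{13}$, $\mathrm{d}\varepsilon_{2345}=xw\varepsilon_{35}-w^2\varepsilon_{45}-z\varepsilon_{24}+xy\varepsilon_{23}$; $\mathrm{d}\varepsilon_{12345}=x\varepsilon_{2345}+z\varepsilon_{124}-w\varepsilon_{1345}-y\varepsilon_{123}$. *)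

theory Defs
  imports "HOL-Analysis.Finite_Cartesian_Product" "HOL-Library.Poly_Mapping"
begin

section \<open>The polynomial ring in four variables\<close>

datatype variable = X | Y | Z | W

text \<open>A polynomial maps exponent vectors to coefficients; multiplication is convolution.\<close>

type_synonym 'k R = "(variable \<Rightarrow>\<^sub>0 nat) \<Rightarrow>\<^sub>0 'k"

definition var :: "variable \<Rightarrow> 'k::field R" where
  "var v = Poly_Mapping.single (Poly_Mapping.single v 1) 1"

abbreviation "vx \<equiv> var X"
abbreviation "vy \<equiv> var Y"
abbreviation "vz \<equiv> var Z"
abbreviation "vw \<equiv> var W"

section \<open>Graded free modules on finite bases\<close>

text \<open>The free module on a finite type \<open>'b\<close> is \<open>'r ^ 'b\<close>; a grading is given by the degrees of
  the basis elements. Zero is homogeneous of every degree.\<close>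

definition homogeneous :: "('b::finite \<Rightarrow> nat) \<Rightarrow> nat \<Rightarrow> 'r::comm_ring_1 ^ 'b \<Rightarrow> bool" where
  "homogeneous deg n a \<longleftrightarrow> (\<forall>b. a $ b \<noteq> 0 \<longrightarrow> deg b = n)"

definition lin_ext :: "('b::finite \<Rightarrow> 'r::comm_ring_1 ^ 'c::finite) \<Rightarrow> 'r ^ 'b \<Rightarrow> 'r ^ 'c" where
  "lin_ext f a = (\<Sum>b\<in>UNIV. a $ b *s f b)"

lemma module_vec: "module ((*s) :: 'r::comm_ring_1 \<Rightarrow> 'r ^ 'b::finite \<Rightarrow> 'r ^ 'b)"
  by standard (simp_all add: vec_eq_iff distrib_left distrib_right mult.assoc)

text \<open>Linear maps of degree 0 commuting with the differentials \<open>d\<close> and \<open>d'\<close>.\<close>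

definition chain_map ::
    "('b::finite \<Rightarrow> nat) \<Rightarrow> ('r::comm_ring_1 ^ 'b \<Rightarrow> 'r ^ 'b) \<Rightarrow>
     ('c::finite \<Rightarrow> nat) \<Rightarrow> ('r ^ 'c \<Rightarrow> 'r ^ 'c) \<Rightarrow> ('r ^ 'b \<Rightarrow> 'r ^ 'c) \<Rightarrow> bool" where
  "chain_map deg d deg' d' f \<longleftrightarrow>
     module_hom (*s) (*s) f \<and>
     (\<forall>n a. homogeneous deg n a \<longrightarrow> homogeneous deg' n (f a)) \<and>
     (\<forall>a. f (d a) = d' (f a))"

text \<open>The tensor product of the free modules on \<open>'b\<close> and \<open>'c\<close> is the free module on \<open>'b \<times> 'c\<close>.\<close>

definition tensor :: "'r::comm_ring_1 ^ 'b::finite \<Rightarrow> 'r ^ 'c::finite \<Rightarrow> 'r ^ ('b \<times> 'c)"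
    (infixl "\<otimes>" 72) where
  "a \<otimes> b = (\<chi> p. a $ fst p * b $ snd p)"

section \<open>The resolution\<close>

text \<open>\<open>I0\<close> indexes the basis element \<open>1\<close> of \<open>F\<^sub>0 = R\<close>.\<close>

datatype idx = I0
  | I1 | I2 | I3 | I4 | I5
  | I12 | I13 | I14 | I23 | I24 | I35 | I45
  | I123 | I124 | I1345 | I2345
  | I12345

lemma UNIV_idx:
  "UNIV = {I0, I1, I2, I3, I4, I5, I12, I13, I14, I23, I24, I35, I45,
           I123, I124, I1345, I2345, I12345}"
  using idx.nchotomy by blast

instance idx :: finite
  by standard (simp add: UNIV_idx)

fun deg :: "idx \<Rightarrow> nat" where
  "deg I0 = 0"
| "deg I1 = 1" | "deg I2 = 1" | "deg I3 = 1" | "deg I4 = 1" | "deg I5 = 1"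
| "deg I12 = 2" | "deg I13 = 2" | "deg I14 = 2" | "deg I23 = 2"
| "deg I24 = 2" | "deg I35 = 2" | "deg I45 = 2"
| "deg I123 = 3" | "deg I124 = 3" | "deg I1345 = 3" | "deg I2345 = 3"
| "deg I12345 = 4"

type_synonym 'k F = "'k R ^ idx"

definition \<epsilon> :: "idx \<Rightarrow> 'k::field F" where
  "\<epsilon> \<sigma> = axis \<sigma> 1"

fun d_basis :: "idx \<Rightarrow> 'k::field F" where
  "d_basis I0 = 0"
| "d_basis I1 = vx^2 *s \<epsilon> I0"
| "d_basis I2 = vw^2 *s \<epsilon> I0"
| "d_basis I3 = vz * vw *s \<epsilon> I0"
| "d_basis I4 = vx * vy *s \<epsilon> I0"
| "d_basis I5 = vy * vz *s \<epsilon> I0"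
| "d_basis I12 = vx^2 *s \<epsilon> I2 - vw^2 *s \<epsilon> I1"
| "d_basis I13 = vx^2 *s \<epsilon> I3 - vz * vw *s \<epsilon> I1"
| "d_basis I14 = vx *s \<epsilon> I4 - vy *s \<epsilon> I1"
| "d_basis I23 = vw *s \<epsilon> I3 - vz *s \<epsilon> I2"
| "d_basis I24 = vw^2 *s \<epsilon> I4 - vx * vy *s \<epsilon> I2"
| "d_basis I35 = vw *s \<epsilon> I5 - vy *s \<epsilon> I3"
| "d_basis I45 = vx *s \<epsilon> I5 - vz *s \<epsilon> I4"
| "d_basis I123 = vx^2 *s \<epsilon> I23 - vw *s \<epsilon> I13 + vz *s \<epsilon> I12"
| "d_basis I124 = vx *s \<epsilon> I24 - vw^2 *s \<epsilon> I14 + vy *s \<epsilon> I12"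
| "d_basis I1345 = vx^2 *s \<epsilon> I35 - vx * vw *s \<epsilon> I45 - vz * vw *s \<epsilon> I14 + vy *s \<epsilon> I13"
| "d_basis I2345 = vx * vw *s \<epsilon> I35 - vw^2 *s \<epsilon> I45 - vz *s \<epsilon> I24 + vx * vy *s \<epsilon> I23"
| "d_basis I12345 = vx *s \<epsilon> I2345 + vz *s \<epsilon> I124 - vw *s \<epsilon> I1345 - vy *s \<epsilon> I123"

definition d :: "'k::field F \<Rightarrow> 'k F" where
  "d = lin_ext d_basis"

lemma sum_idx:
  "(\<Sum>\<sigma>\<in>UNIV. f \<sigma>) = f I0 + f I1 + f I2 + f I3 + f I4 + f I5 + f I12 + f I13 + f I14 + f I23
     + f I24 + f I35 + f I45 + f I123 + f I124 + f I1345 + f I2345 + f I12345"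
  for f :: "idx \<Rightarrow> 'a::comm_monoid_add"
  by (simp add: UNIV_idx add.assoc)

lemma d_\<epsilon>: "d (\<epsilon> \<sigma>) = d_basis \<sigma>"
proof -
  have "d (\<epsilon> \<sigma>) = (\<Sum>\<tau>\<in>UNIV. if \<tau> = \<sigma> then d_basis \<tau> else 0)"
    unfolding d_def lin_ext_def \<epsilon>_def
    by (rule sum.cong) (auto simp: axis_def vec_eq_iff)
  then show ?thesis by simp
qed

lemma d_add: "d (a + b) = d a + d b"
  by (simp add: d_def lin_ext_def sum.distrib[symmetric] vec_eq_iff distrib_right)

lemma d_scale: "d (r *s a) = r *s d a"
  by (simp add: d_def lin_ext_def vec_eq_iff sum_distrib_left mult.assoc)

lemma d_diff: "d (a - b) = d a - d b"
  by (simp add: d_def lin_ext_def sum_subtractf[symmetric] vec_eq_iff left_diff_distrib)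

lemma d_zero: "d 0 = 0"
  by (simp add: d_def lin_ext_def vec_eq_iff)

lemma d_sum: "d (sum f A) = (\<Sum>a\<in>A. d (f a))"
  by (induction A rule: infinite_finite_induct) (simp_all add: d_zero d_add)

lemma d_d_basis: "d (d_basis \<sigma>) = 0"
  by (cases \<sigma>)
    (simp_all add: d_add d_diff d_scale d_zero d_\<epsilon> vec_eq_iff algebra_simps power2_eq_square)

lemma d_d: "d (d a) = 0"
proof -
  have "d (d a) = (\<Sum>\<sigma>\<in>UNIV. a $ \<sigma> *s d (d_basis \<sigma>))"
    by (simp add: d_def lin_ext_def[of d_basis a] d_sum[unfolded d_def] d_scale[unfolded d_def])
  also have "\<dots> = 0"
    by (simp add: d_d_basis vec_eq_iff)
  finally show ?thesis .
qed

text \<open>The image of \<open>F\<^sub>1\<close> in \<open>F\<^sub>0 = R\<close> is the ideal generated by \<open>x\<^sup>2, w\<^sup>2, zw, xy, yz\<close>.\<close>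

lemma range_d_degree_0:
  "range (\<lambda>a::'k::field F. d a $ I0) =
     {c1 * vx^2 + c2 * vw^2 + c3 * (vz * vw) + c4 * (vx * vy) + c5 * (vy * vz) | c1 c2 c3 c4 c5. True}"
proof -
  have *: "d a $ I0 = a $ I1 * vx^2 + a $ I2 * vw^2 + a $ I3 * (vz * vw) + a $ I4 * (vx * vy)
      + a $ I5 * (vy * vz)" for a :: "'k F"
    by (simp add: d_def lin_ext_def sum_idx \<epsilon>_def axis_def)
  show ?thesis
  proof (safe)
    fix a :: "'k F"
    show "\<exists>c1 c2 c3 c4 c5. d a $ I0 = c1 * vx^2 + c2 * vw^2 + c3 * (vz * vw) + c4 * (vx * vy)
        + c5 * (vy * vz) \<and> True"
      using * by blast
  next
    fix c1 c2 c3 c4 c5 :: "'k R"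
    let ?a = "c1 *s \<epsilon> I1 + c2 *s \<epsilon> I2 + c3 *s \<epsilon> I3 + c4 *s \<epsilon> I4 + c5 *s \<epsilon> I5 :: 'k F"
    have "d ?a $ I0 = c1 * vx^2 + c2 * vw^2 + c3 * (vz * vw) + c4 * (vx * vy) + c5 * (vy * vz)"
      unfolding * by (simp add: \<epsilon>_def axis_def)
    then show "c1 * vx^2 + c2 * vw^2 + c3 * (vz * vw) + c4 * (vx * vy) + c5 * (vy * vz)
        \<in> range (\<lambda>a::'k F. d a $ I0)"
      by (metis rangeI)
  qed
qed

section \<open>Multiplications\<close>

definition deg2 :: "idx \<times> idx \<Rightarrow> nat" where
  "deg2 p = deg (fst p) + deg (snd p)"

definition d2 :: "'k::field R ^ (idx \<times> idx) \<Rightarrow> 'k R ^ (idx \<times> idx)" where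
  "d2 = lin_ext (\<lambda>(\<sigma>, \<tau>). d (\<epsilon> \<sigma>) \<otimes> \<epsilon> \<tau> + (-1) ^ deg \<sigma> *s (\<epsilon> \<sigma> \<otimes> d (\<epsilon> \<tau>)))"

definition is_multiplication :: "('k::field F \<Rightarrow> 'k F \<Rightarrow> 'k F) \<Rightarrow> bool" where
  "is_multiplication m \<longleftrightarrow>
     (\<exists>\<mu>. chain_map deg2 d2 deg d \<mu> \<and> (\<forall>a b. m a b = \<mu> (a \<otimes> b))) \<and>
     (\<forall>a. m (\<epsilon> I0) a = a \<and> m a (\<epsilon> I0) = a) \<and>
     (\<forall>i j a b. homogeneous deg i a \<longrightarrow> homogeneous deg j b \<longrightarrow> m a b = (-1) ^ (i * j) *s m b a) \<and>
     (\<forall>i a. odd i \<longrightarrow> homogeneous deg i a \<longrightarrow> m a a = 0)"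

end

theory Submission
  imports Defs
begin

text \<open>
  Let \<open>A \<in> F\<^sub>4\<close> be the associator of \<open>(\<epsilon>\<^sub>1, \<epsilon>\<^sub>4\<^sub>5, \<epsilon>\<^sub>2)\<close>. By the Leibniz rule the
  \<open>\<epsilon>\<^sub>2\<^sub>3\<^sub>4\<^sub>5\<close>-coordinate of \<open>d A\<close>, which is \<open>x\<close> times the coefficient of \<open>A\<close>, agrees modulo
  \<open>(y, z, w)\<close> with \<open>-x\<close> times that of the associator of \<open>(\<epsilon>\<^sub>1, \<epsilon>\<^sub>5, \<epsilon>\<^sub>2)\<close>. The values of \<open>d\<close>
  on \<open>\<epsilon>\<^sub>1 \<star> \<epsilon>\<^sub>5\<close> and \<open>\<epsilon>\<^sub>5 \<star> \<epsilon>\<^sub>2\<close> pin down enough low-order coefficients of these products to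
  show that the monomial \<open>x\<close> occurs in \<open>A\<close> with coefficient \<open>1\<close>, whatever the multiplication is.
\<close>

section \<open>Coefficients of polynomials\<close>

definition mono_exp :: "nat \<Rightarrow> nat \<Rightarrow> nat \<Rightarrow> nat \<Rightarrow> variable \<Rightarrow>\<^sub>0 nat" where
  "mono_exp a b c e = Poly_Mapping.single X a + Poly_Mapping.single Y b
     + Poly_Mapping.single Z c + Poly_Mapping.single W e"

definition cf :: "'k::field R \<Rightarrow> nat \<Rightarrow> nat \<Rightarrow> nat \<Rightarrow> nat \<Rightarrow> 'k" where
  "cf p a b c e = Poly_Mapping.lookup p (mono_exp a b c e)"

lemma lookup_mono_exp:
  "Poly_Mapping.lookup (mono_exp a b c e) v = (case v of X \<Rightarrow> a | Y \<Rightarrow> b | Z \<Rightarrow> c | W \<Rightarrow> e)"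
  by (cases v) (simp_all add: mono_exp_def lookup_add lookup_single)

lemma mono_exp_eq_iff:
  "mono_exp a b c e = mono_exp a' b' c' e' \<longleftrightarrow> a = a' \<and> b = b' \<and> c = c' \<and> e = e'"
  by (metis lookup_mono_exp variable.case)

lemma mono_exp_zero: "mono_exp 0 0 0 0 = 0"
  by (simp add: mono_exp_def)

lemma cf_zero [simp]: "cf 0 a b c e = 0"
  and cf_add [simp]: "cf (p + q) a b c e = cf p a b c e + cf q a b c e"
  and cf_diff [simp]: "cf (p - q) a b c e = cf p a b c e - cf q a b c e"
  and cf_uminus [simp]: "cf (- p) a b c e = - cf p a b c e"
  by (simp_all add: cf_def lookup_add lookup_minus)

lemma cf_one [simp]: "cf 1 a b c e = (if a = 0 \<and> b = 0 \<and> c = 0 \<and> e = 0 then 1 else 0)"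
  unfolding cf_def lookup_one mono_exp_zero[symmetric] mono_exp_eq_iff by (auto simp: when_def)

text \<open>By cancellation at most one \<open>q\<close> contributes. This collapses the inner sum
  of the convolution in \<open>lookup_mult\<close>.\<close>

lemma Sum_any_lookup_when:
  fixes p :: "('a::cancel_comm_monoid_add) \<Rightarrow>\<^sub>0 'k::comm_monoid_add"
  shows "Sum_any (\<lambda>q. Poly_Mapping.lookup p q when k = l + q)
    = (Poly_Mapping.lookup p (k - l) when (\<exists>q. k = l + q))"
proof (cases "\<exists>q. k = l + q")
  case True
  then obtain m where "k = l + m" ..
  then show ?thesis by simp
qed simp

lemma lookup_var_times:
  fixes p :: "'k::field R"
  shows "Poly_Mapping.lookup (var v * p) k
    = (if Poly_Mapping.lookup k v = 0 then 0
       else Poly_Mapping.lookup p (k - Poly_Mapping.single v 1))"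
proof -
  have "Poly_Mapping.lookup (var v * p) k
      = Sum_any (\<lambda>q. Poly_Mapping.lookup p q when k = Poly_Mapping.single v 1 + q)"
    by (simp add: lookup_mult var_def lookup_single when_mult)
  moreover have "(\<exists>q. k = Poly_Mapping.single v 1 + q) \<longleftrightarrow> Poly_Mapping.lookup k v \<noteq> 0"
  proof
    assume "Poly_Mapping.lookup k v \<noteq> 0"
    then have "k = Poly_Mapping.single v 1 + (k - Poly_Mapping.single v 1)"
      by (intro poly_mapping_eqI) (auto simp: lookup_add lookup_minus lookup_single when_def)
    then show "\<exists>q. k = Poly_Mapping.single v 1 + q" ..
  qed (auto simp: lookup_add)
  ultimately show ?thesis by (simp add: Sum_any_lookup_when)
qed

lemma mono_exp_diff_single:
  "mono_exp a b c e - Poly_Mapping.single X n = mono_exp (a - n) b c e"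
  "mono_exp a b c e - Poly_Mapping.single Y n = mono_exp a (b - n) c e"
  "mono_exp a b c e - Poly_Mapping.single Z n = mono_exp a b (c - n) e"
  "mono_exp a b c e - Poly_Mapping.single W n = mono_exp a b c (e - n)"
  by (auto intro!: poly_mapping_eqI
      simp: lookup_minus lookup_mono_exp lookup_single when_def split: variable.split)

text \<open>Coefficients are computed by peeling variables off the front of a product, which is why
  products are later kept right-nested with squares expanded.\<close>

lemma cf_var_times [simp]:
  "cf (vx * p) a b c e = (if a = 0 then 0 else cf p (a - 1) b c e)"
  "cf (vy * p) a b c e = (if b = 0 then 0 else cf p a (b - 1) c e)"
  "cf (vz * p) a b c e = (if c = 0 then 0 else cf p a b (c - 1) e)"
  "cf (vw * p) a b c e = (if e = 0 then 0 else cf p a b c (e - 1))"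
  unfolding cf_def lookup_var_times lookup_mono_exp mono_exp_diff_single by simp_all

lemma cf_var [simp]:
  "cf vx a b c e = (if a = 0 then 0 else cf 1 (a - 1) b c e)"
  "cf vy a b c e = (if b = 0 then 0 else cf 1 a (b - 1) c e)"
  "cf vz a b c e = (if c = 0 then 0 else cf 1 a b (c - 1) e)"
  "cf vw a b c e = (if e = 0 then 0 else cf 1 a b c (e - 1))"
  using cf_var_times[of 1] by (simp_all only: mult_1_right)

text \<open>The monomial x factors only as 1 * x and x * 1, so two terms of the convolution
  survive.\<close>

lemma cf_times_X:
  "cf (p * q) 1 0 0 0 = cf p 0 0 0 0 * cf q 1 0 0 0 + cf p 1 0 0 0 * cf q 0 0 0 0"
proof -
  let ?k = "Poly_Mapping.single X (1::nat)"
  let ?f = "\<lambda>l. Poly_Mapping.lookup p l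
    * (Poly_Mapping.lookup q (?k - l) when (\<exists>q. ?k = l + q))"
  have *: "l = 0 \<or> l = ?k" if k: "?k = l + m" for l m
  proof -
    have sum: "Poly_Mapping.lookup l v + Poly_Mapping.lookup m v = (1 when X = v)" for v
      using arg_cong[OF k, of "\<lambda>k. Poly_Mapping.lookup k v"]
      by (simp add: lookup_add lookup_single)
    have "Poly_Mapping.lookup l v = 0" if "v \<noteq> X" for v
      using sum[of v] that by (auto simp: when_def)
    moreover have "Poly_Mapping.lookup l X = 0 \<or> Poly_Mapping.lookup l X = 1"
      using sum[of X] by auto
    ultimately show ?thesis
      by (metis (mono_tags, lifting) lookup_single_eq lookup_single_not_eq lookup_zero
          poly_mapping_eqI)
  qed
  have "Poly_Mapping.lookup (p * q) ?k = Sum_any ?f"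
    by (simp add: lookup_mult Sum_any_lookup_when)
  also have "\<dots> = sum ?f {0, ?k}"
  proof (rule Sum_any.expand_superset)
    have "\<exists>m. ?k = l + m" if "?f l \<noteq> 0" for l
      by (rule ccontr) (use that in simp)
    then show "{l. ?f l \<noteq> 0} \<subseteq> {0, ?k}"
      using * by blast
  qed simp
  also have "\<dots> = Poly_Mapping.lookup p 0 * Poly_Mapping.lookup q ?k
      + Poly_Mapping.lookup p ?k * Poly_Mapping.lookup q 0"
  proof -
    have "?k \<noteq> 0" by (metis lookup_single_eq lookup_zero zero_neq_one)
    moreover have "\<exists>q. ?k = ?k + q" by (rule exI[of _ 0]) simp
    ultimately show ?thesis by simp
  qed
  finally show ?thesis by (simp add: cf_def mono_exp_def)
qed

section \<open>Multiplications on the resolution\<close>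

lemma tensor_add_left: "(a + b) \<otimes> c = a \<otimes> c + b \<otimes> c"
  and tensor_add_right: "a \<otimes> (b + c) = a \<otimes> b + a \<otimes> c"
  and tensor_scale_left: "(r *s a) \<otimes> b = r *s (a \<otimes> b)"
  and tensor_scale_right: "a \<otimes> (r *s b) = r *s (a \<otimes> b)"
  by (simp_all add: tensor_def vec_eq_iff algebra_simps)

lemma F_expand: "a = (\<Sum>\<sigma>\<in>UNIV. a $ \<sigma> *s \<epsilon> \<sigma>)"
  by (simp add: \<epsilon>_def basis_expansion)

lemma eps_nth: "\<epsilon> \<sigma> $ \<tau> = (if \<sigma> = \<tau> then 1 else 0)"
  by (simp add: \<epsilon>_def axis_def)

lemma homogeneous_\<epsilon>: "homogeneous deg (deg \<sigma>) (\<epsilon> \<sigma>)"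
  by (simp add: homogeneous_def \<epsilon>_def axis_def)

text \<open>These are the coordinates from which coefficients are read off below; the variables
  stand in front to suit \<open>cf_var_times\<close>.\<close>

lemma d_nth:
  fixes a :: "'k::field F"
  shows "d a $ I2 = vx * (vx * a $ I12) - vz * a $ I23 - vx * (vy * a $ I24)"
    "d a $ I3 = vx * (vx * a $ I13) + vw * a $ I23 - vy * a $ I35"
    "d a $ I4 = vx * a $ I14 + vw * (vw * a $ I24) - vz * a $ I45"
    "d a $ I5 = vw * a $ I35 + vx * a $ I45"
    "d a $ I45 = - (vx * (vw * a $ I1345)) - vw * (vw * a $ I2345)"
    "d a $ I2345 = vx * a $ I12345"
  by (simp_all add: d_def lin_ext_def sum_idx \<epsilon>_def axis_def algebra_simps power2_eq_square)

context
  fixes star :: "'k::field F \<Rightarrow> 'k F \<Rightarrow> 'k F" (infixl "\<star>" 75)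
  assumes mult: "is_multiplication (\<star>)"
begin

lemma star_tensor_map:
  obtains \<mu> where "module_hom (*s) (*s) \<mu>" "\<And>n a. homogeneous deg2 n a \<Longrightarrow> homogeneous deg n (\<mu> a)"
    "\<And>a. \<mu> (d2 a) = d (\<mu> a)" "\<And>a b. a \<star> b = \<mu> (a \<otimes> b)"
  using mult unfolding is_multiplication_def chain_map_def by blast

lemma star_add_left: "(a + b) \<star> c = a \<star> c + b \<star> c"
  and star_add_right: "a \<star> (b + c) = a \<star> b + a \<star> c"
  and star_scale_left: "(r *s a) \<star> b = r *s (a \<star> b)"
  and star_scale_right: "a \<star> (r *s b) = r *s (a \<star> b)"
  by (rule star_tensor_map; simp add: tensor_add_left tensor_add_right tensor_scale_left
      tensor_scale_right module_hom.add module_hom.scale)+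

lemma star_diff_left: "(a - b) \<star> c = a \<star> c - b \<star> c"
  by (metis add_diff_cancel diff_add_cancel star_add_left)

lemma star_diff_right: "a \<star> (b - c) = a \<star> b - a \<star> c"
  by (metis add_diff_cancel diff_add_cancel star_add_right)

lemma star_zero_left: "0 \<star> a = 0"
  by (metis add_cancel_right_right star_add_left)

lemma star_zero_right: "a \<star> 0 = 0"
  by (metis add_cancel_right_right star_add_right)

lemma star_unit [simp]: "\<epsilon> I0 \<star> a = a" "a \<star> \<epsilon> I0 = a"
  using mult by (simp_all add: is_multiplication_def)

lemma star_sum_left: "(\<Sum>i\<in>I. r i *s g i) \<star> b = (\<Sum>i\<in>I. r i *s (g i \<star> b))"
  by (induction I rule: infinite_finite_induct)
    (simp_all add: star_zero_left star_add_left star_scale_left)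

lemma star_sum_right: "b \<star> (\<Sum>i\<in>I. r i *s g i) = (\<Sum>i\<in>I. r i *s (b \<star> g i))"
  by (induction I rule: infinite_finite_induct)
    (simp_all add: star_zero_right star_add_right star_scale_right)

lemma star_homogeneous:
  assumes "homogeneous deg i a" "homogeneous deg j b"
  shows "homogeneous deg (i + j) (a \<star> b)"
proof -
  have "homogeneous deg2 (i + j) (a \<otimes> b)"
    using assms by (auto simp: homogeneous_def deg2_def tensor_def dest!: mult_not_zero)
  moreover obtain \<mu> where "\<And>n a. homogeneous deg2 n a \<Longrightarrow> homogeneous deg n (\<mu> a)"
    "\<And>a b. a \<star> b = \<mu> (a \<otimes> b)"
    by (rule star_tensor_map) blast
  ultimately show ?thesis by simp
qed

text \<open>This is the chain map condition at a basis tensor, where the sum defining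
  \<open>d2\<close> has a single nonzero term.\<close>

lemma d_star_basis:
  "d (\<epsilon> \<sigma> \<star> \<epsilon> \<tau>) = d (\<epsilon> \<sigma>) \<star> \<epsilon> \<tau> + (-1) ^ deg \<sigma> *s (\<epsilon> \<sigma> \<star> d (\<epsilon> \<tau>))"
proof -
  obtain \<mu> where \<mu>: "module_hom (*s) (*s) \<mu>" "\<And>a. \<mu> (d2 a) = d (\<mu> a)" "\<And>a b. a \<star> b = \<mu> (a \<otimes> b)"
    by (rule star_tensor_map) blast
  have eps: "(\<epsilon> \<sigma> \<otimes> \<epsilon> \<tau> :: 'k R ^ (idx \<times> idx)) = axis (\<sigma>, \<tau>) 1"
    by (auto simp: tensor_def \<epsilon>_def axis_def vec_eq_iff)
  have "d2 (\<epsilon> \<sigma> \<otimes> \<epsilon> \<tau> :: 'k R ^ (idx \<times> idx))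
      = (\<Sum>p\<in>UNIV. if p = (\<sigma>, \<tau>)
          then d (\<epsilon> \<sigma>) \<otimes> \<epsilon> \<tau> + (-1) ^ deg \<sigma> *s (\<epsilon> \<sigma> \<otimes> d (\<epsilon> \<tau>)) else 0)"
    unfolding d2_def lin_ext_def eps by (intro sum.cong) (auto simp: axis_def vec_eq_iff)
  then have "d2 (\<epsilon> \<sigma> \<otimes> \<epsilon> \<tau> :: 'k R ^ (idx \<times> idx))
      = d (\<epsilon> \<sigma>) \<otimes> \<epsilon> \<tau> + (-1) ^ deg \<sigma> *s (\<epsilon> \<sigma> \<otimes> d (\<epsilon> \<tau>))"
    by simp
  then show ?thesis
    by (simp add: \<mu>(3) \<mu>(2)[symmetric] module_hom.add[OF \<mu>(1)] module_hom.scale[OF \<mu>(1)])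
qed

text \<open>The Leibniz sign depends on the degree of the left factor, so extending from basis
  elements by linearity requires \<open>a\<close> to be homogeneous.\<close>

lemma d_star_left:
  assumes "homogeneous deg n a"
  shows "d (a \<star> \<epsilon> \<tau>) = d a \<star> \<epsilon> \<tau> + (-1) ^ n *s (a \<star> d (\<epsilon> \<tau>))"
proof -
  have "d (a \<star> \<epsilon> \<tau>) = (\<Sum>\<sigma>\<in>UNIV. a $ \<sigma> *s d (\<epsilon> \<sigma> \<star> \<epsilon> \<tau>))"
    by (subst F_expand[of a]) (simp only: star_sum_left d_sum d_scale)
  also have "\<dots> = (\<Sum>\<sigma>\<in>UNIV. a $ \<sigma> *s (d (\<epsilon> \<sigma>) \<star> \<epsilon> \<tau>)
      + (-1) ^ n *s (a $ \<sigma> *s (\<epsilon> \<sigma> \<star> d (\<epsilon> \<tau>))))"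
  proof (intro sum.cong refl)
    fix \<sigma>
    have "a $ \<sigma> = 0 \<or> deg \<sigma> = n" using assms by (auto simp: homogeneous_def)
    then show "a $ \<sigma> *s d (\<epsilon> \<sigma> \<star> \<epsilon> \<tau>) = a $ \<sigma> *s (d (\<epsilon> \<sigma>) \<star> \<epsilon> \<tau>)
        + (-1) ^ n *s (a $ \<sigma> *s (\<epsilon> \<sigma> \<star> d (\<epsilon> \<tau>)))"
      by (auto simp: d_star_basis vec_eq_iff algebra_simps)
  qed
  also have "\<dots> = d (\<Sum>\<sigma>\<in>UNIV. a $ \<sigma> *s \<epsilon> \<sigma>) \<star> \<epsilon> \<tau>
      + (-1) ^ n *s ((\<Sum>\<sigma>\<in>UNIV. a $ \<sigma> *s \<epsilon> \<sigma>) \<star> d (\<epsilon> \<tau>))"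
    by (simp add: d_sum d_scale star_sum_left sum.distrib vec_eq_iff sum_distrib_left)
  finally show ?thesis by (simp only: F_expand[symmetric])
qed

lemma d_star_right:
  "d (\<epsilon> \<sigma> \<star> a) = d (\<epsilon> \<sigma>) \<star> a + (-1) ^ deg \<sigma> *s (\<epsilon> \<sigma> \<star> d a)"
proof -
  have "d (\<epsilon> \<sigma> \<star> a) = (\<Sum>\<tau>\<in>UNIV. a $ \<tau> *s d (\<epsilon> \<sigma> \<star> \<epsilon> \<tau>))"
    by (subst F_expand[of a]) (simp only: star_sum_right d_sum d_scale)
  also have "\<dots> = d (\<epsilon> \<sigma>) \<star> (\<Sum>\<tau>\<in>UNIV. a $ \<tau> *s \<epsilon> \<tau>)
      + (-1) ^ deg \<sigma> *s (\<epsilon> \<sigma> \<star> d (\<Sum>\<tau>\<in>UNIV. a $ \<tau> *s \<epsilon> \<tau>))"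
    by (simp add: d_star_basis d_sum d_scale star_sum_right sum.distrib vec_eq_iff sum_distrib_left
        distrib_left mult.left_commute)
  finally show ?thesis by (simp only: F_expand[symmetric])
qed

end

section \<open>Low-order coefficients of products\<close>

text \<open>Intended for \<open>c \<sigma>\<close> the \<open>I2345\<close> coordinate of
  \<open>\<epsilon> \<sigma> \<star> \<epsilon> I2\<close> or of
  \<open>\<epsilon> I1 \<star> \<epsilon> \<sigma>\<close>. By \<open>cf_times_X\<close> only the
  constant and x coefficients of \<open>a\<close> matter, and the conditions on \<open>d a\<close>
  kill all of them except the x coefficients at \<open>I24\<close> and \<open>I45\<close>. The one
  at \<open>I24\<close> is not determined by \<open>d a\<close>: adding \<open>d_basis I124\<close>
  to \<open>a\<close> changes it but not \<open>d a\<close>. The hypothesis on \<open>c I24\<close>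
  removes its contribution.\<close>

lemma cf_sum_deg_2:
  fixes a :: "'k::field F"
  assumes a: "homogeneous deg 2 a"
    and da: "d a $ I2 = 0 \<or> d a $ I2 = vy * vz" "d a $ I3 = 0" "d a $ I4 = 0"
      "cf (d a $ I5) 1 0 0 0 = 0"
    and c: "cf (c I24) 0 0 0 0 = 0"
  shows "cf (\<Sum>\<sigma>\<in>UNIV. a $ \<sigma> * c \<sigma>) 1 0 0 0 = cf (d a $ I5) 2 0 0 0 * cf (c I45) 0 0 0 0"
proof -
  have "a $ I0 = 0" "a $ I1 = 0" "a $ I2 = 0" "a $ I3 = 0" "a $ I4 = 0" "a $ I5 = 0"
    "a $ I123 = 0" "a $ I124 = 0" "a $ I1345 = 0" "a $ I2345 = 0" "a $ I12345 = 0"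
    using a by (force simp: homogeneous_def)+
  \<comment> \<open>Each coefficient below is isolated by a monomial of \<open>d a\<close> to which no other coordinate of
    \<open>a\<close> contributes.\<close>
  moreover have "cf (a $ I12) 0 0 0 0 = 0" "cf (a $ I12) 1 0 0 0 = 0"
    "cf (a $ I23) 0 0 0 0 = 0" "cf (a $ I23) 1 0 0 0 = 0" "cf (a $ I24) 0 0 0 0 = 0"
  proof -
    have *: "cf (d a $ I2) i j k l = 0" if "j = 0 \<or> k = 0" for i j k l
      using da(1) that by auto
    show "cf (a $ I12) 0 0 0 0 = 0" "cf (a $ I12) 1 0 0 0 = 0"
      "cf (a $ I23) 0 0 0 0 = 0" "cf (a $ I23) 1 0 0 0 = 0" "cf (a $ I24) 0 0 0 0 = 0"
      \<comment> \<open>The premise of \<open>*\<close> comes first, so the arguments stand for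
        \<open>j\<close>, \<open>k\<close>, \<open>i\<close>, \<open>l\<close>; the monomials tested
        are x^2, x^3, z, xz and xy.\<close>
      using *[of 0 0 2 0] *[of 0 0 3 0] *[of 0 1 0 0] *[of 0 1 1 0] *[of 1 0 1 0]
      by (simp_all add: d_nth)
  qed
  moreover have "cf (a $ I13) 0 0 0 0 = 0" "cf (a $ I13) 1 0 0 0 = 0"
    "cf (a $ I35) 0 0 0 0 = 0" "cf (a $ I35) 1 0 0 0 = 0"
    using arg_cong[OF da(2), of "\<lambda>p. cf p 2 0 0 0"] arg_cong[OF da(2), of "\<lambda>p. cf p 3 0 0 0"]
      arg_cong[OF da(2), of "\<lambda>p. cf p 0 1 0 0"] arg_cong[OF da(2), of "\<lambda>p. cf p 1 1 0 0"]
    by (simp_all add: d_nth)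
  moreover have "cf (a $ I14) 0 0 0 0 = 0" "cf (a $ I14) 1 0 0 0 = 0"
    using arg_cong[OF da(3), of "\<lambda>p. cf p 1 0 0 0"] arg_cong[OF da(3), of "\<lambda>p. cf p 2 0 0 0"]
    by (simp_all add: d_nth)
  moreover have "cf (a $ I45) 0 0 0 0 = 0" "cf (a $ I45) 1 0 0 0 = cf (d a $ I5) 2 0 0 0"
    using da(4) by (simp_all add: d_nth)
  ultimately show ?thesis
    using c by (simp add: sum_idx cf_times_X[simplified])
qed

theorem theorem3p2:
  fixes star :: "'k::field F \<Rightarrow> 'k F \<Rightarrow> 'k F" (infixl "\<star>" 75)
  assumes "is_multiplication (\<star>)"
  shows "(\<epsilon> I1 \<star> \<epsilon> I45) \<star> \<epsilon> I2 - \<epsilon> I1 \<star> (\<epsilon> I45 \<star> \<epsilon> I2) \<noteq> 0"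
proof -
  note d_star = d_star_basis[OF assms] d_\<epsilon>
  note star_bilinear = star_add_left[OF assms] star_add_right[OF assms]
    star_diff_left[OF assms] star_diff_right[OF assms]
    star_scale_left[OF assms] star_scale_right[OF assms] star_unit[OF assms]
  note simps = d_star star_bilinear eps_nth power2_eq_square mult.assoc
  let ?a = "\<epsilon> I1 \<star> \<epsilon> I5" and ?v = "\<epsilon> I5 \<star> \<epsilon> I2"
  let ?A = "(\<epsilon> I1 \<star> \<epsilon> I45) \<star> \<epsilon> I2 - \<epsilon> I1 \<star> (\<epsilon> I45 \<star> \<epsilon> I2)"
  have star_deg_1: "homogeneous deg 2 (\<epsilon> \<sigma> \<star> \<epsilon> \<tau>)" if "deg \<sigma> = 1" "deg \<tau> = 1" for \<sigma> \<tau>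
    using star_homogeneous[OF assms homogeneous_\<epsilon>[of \<sigma>] homogeneous_\<epsilon>[of \<tau>]] that
    by (simp add: numeral_2_eq_2)
  \<comment> \<open>In the \<open>I45\<close> coordinate of \<open>d b\<close>,
    \<open>b $ I1345\<close> carries the factor xw, so the monomial w^2 sees only
    \<open>b $ I2345\<close>.\<close>
  have cf_2345: "cf (b $ I2345) 0 0 0 0 = - cf (d b $ I45) 0 0 0 2" for b :: "'k F"
    by (simp add: d_nth)

  \<comment> \<open>Preparation for the condition on \<open>c I24\<close>: in
    \<open>d (\<epsilon> I24 \<star> \<epsilon> I2)\<close> the product
    \<open>\<epsilon> I4 \<star> \<epsilon> I2\<close> carries w^2, while the unknown
    \<open>\<epsilon> I2 \<star> \<epsilon> I2\<close> carries xy and cannot reach w^2.\<close>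
  have "cf ((\<epsilon> I4 \<star> \<epsilon> I2) $ I45) 0 0 0 0 = cf (d (\<epsilon> I4 \<star> \<epsilon> I2) $ I5) 1 0 0 0"
    by (simp add: d_nth)
  also have "\<dots> = 0"
    by (simp add: simps)
  finally have "cf ((\<epsilon> I24 \<star> \<epsilon> I2) $ I2345) 0 0 0 0 = 0"
    by (simp add: cf_2345 simps)
  then have "cf ((?a \<star> \<epsilon> I2) $ I2345) 1 0 0 0
      = cf (d ?a $ I5) 2 0 0 0 * cf ((\<epsilon> I45 \<star> \<epsilon> I2) $ I2345) 0 0 0 0"
    by (subst F_expand[of ?a], simp only: star_sum_left[OF assms] sum_component
        vector_smult_component, intro cf_sum_deg_2)
      (simp_all add: star_deg_1 simps)
  \<comment> \<open>The Leibniz term w^2 \<open>\<epsilon> I45\<close> supplies the value; the other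
    terms carry x or z. The sign comes from \<open>cf_2345\<close>.\<close>
  also have "cf ((\<epsilon> I45 \<star> \<epsilon> I2) $ I2345) 0 0 0 0 = - 1"
    by (simp add: cf_2345 simps)
  also have "cf (d ?a $ I5) 2 0 0 0 = 1"
    by (simp add: simps)
  finally have left: "cf ((?a \<star> \<epsilon> I2) $ I2345) 1 0 0 0 = - 1" by simp

  have "cf ((\<epsilon> I1 \<star> \<epsilon> I4) $ I45) 0 0 0 0 = cf (d (\<epsilon> I1 \<star> \<epsilon> I4) $ I5) 1 0 0 0"
    by (simp add: d_nth)
  also have "\<dots> = 0"
    by (simp add: simps)
  finally have "cf ((\<epsilon> I1 \<star> \<epsilon> I24) $ I2345) 0 0 0 0 = 0"
    by (simp add: cf_2345 simps)
  then have "cf ((\<epsilon> I1 \<star> ?v) $ I2345) 1 0 0 0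
      = cf (d ?v $ I5) 2 0 0 0 * cf ((\<epsilon> I1 \<star> \<epsilon> I45) $ I2345) 0 0 0 0"
    by (subst F_expand[of ?v], simp only: star_sum_right[OF assms] sum_component
        vector_smult_component, intro cf_sum_deg_2)
      (simp_all add: star_deg_1 simps)
  \<comment> \<open>This coordinate is -w^2, so the unknown coefficient of
    \<open>\<epsilon> I1 \<star> \<epsilon> I45\<close> is multiplied by 0.\<close>
  also have "cf (d ?v $ I5) 2 0 0 0 = 0"
    by (simp add: simps)
  finally have right: "cf ((\<epsilon> I1 \<star> ?v) $ I2345) 1 0 0 0 = 0" by simp

  have "homogeneous deg 3 (\<epsilon> I1 \<star> \<epsilon> I45)"
    using star_homogeneous[OF assms homogeneous_\<epsilon>[of I1] homogeneous_\<epsilon>[of I45]]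
    by (simp add: eval_nat_numeral)
  note d_A = d_diff d_star_left[OF assms this] d_star_right[OF assms]
  have "cf (?A $ I12345) 1 0 0 0 = cf (d ?A $ I2345) 2 0 0 0"
    by (simp add: d_nth)
  \<comment> \<open>The terms x^2 (\<open>\<epsilon> I45 \<star> \<epsilon> I2\<close>) of the two
    bracketings cancel, and terms with a factor z or w^2 do not reach x^2. The rest comes from x
    \<open>\<epsilon> I5\<close> in \<open>d_basis I45\<close>, whose factor x lowers x^2 to
    x.\<close>
  also have "\<dots> = cf ((\<epsilon> I1 \<star> ?v) $ I2345) 1 0 0 0 - cf ((?a \<star> \<epsilon> I2) $ I2345) 1 0 0 0"
    by (simp add: d_A simps)
  also have "\<dots> = 1"
    by (simp only: left right) simp
  finally show ?thesis
    by (metis cf_zero zero_index zero_neq_one)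
qed

end
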